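(* Let $q$ be odd, $V$ an $n$-dimensional space over $\mathbb{F}_q$, $n\ge4$, with a non-degenerate alternating form ($G=\mathrm{Sp}(V)$, $q_0=q$) or a non-degenerate hermitian form ($G=\mathrm{SU}(V)$, $q=q_0^2$). Let $\mathcal T$ be the set of transvections of $G$ and $X\subseteq\mathcal T$ a generating set of $G$ such that ${}_VX$ spans $V$, $X_{V^*}$ spans $V^*$, $\Gamma(X)$ is strongly connected, the weights of all cycles of $\Gamma(X)$ generate $\mathbb{F}_q$, the directed diameter of $\Gamma(X'')$ is at most $2$ and its two-way diameter is at most $6$ for every $X\subseteq X''\subseteq\mathcal T$. If $L_3(X)=\mathbb{F}_q$ and $|\mathbb{F}_q:L_2(X)|\le2$, then $L_2(X^{(3)})=\mathbb{F}_q$ in the symplectic case and $L_2(X)=\mathbb{F}_{q_0}$ in the unitary case.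
   Context: Transvections $s=1+u_s\otimes\phi_s$ ($x\mapsto x+\phi_s(x)u_s$). $\Gamma(Y)$: directed graph on $Y$ with edge $[s,t]$ iff $\phi_t(u_s)\ne0$ (two-way if both directions are edges). Weight of $(r_1,\dots,r_k)$: $\prod_{i=1}^k\phi_{r_{i+1}}(u_{r_i})$ (indices mod $k$); a cycle is a tuple with nonzero weight. $L_k(Y)$: subfield generated by the weights of the cycles of $\Gamma(Y)$ of length at most $k$. $Y^{(k)}$: the set of transvections which can be written as a product of at most $k$ elements of $Y\cup Y^{-1}$. ${}_VX$, $X_{V^*}$: the sets of $u_s$, resp. $\phi_s$, $s\in X$. *)

theory Defs
  imports "HOL-Analysis.Analysis"
begin

text \<open>V = 'a^'n, the field 'a is finite. Linear functionals on V are represented by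
coefficient vectors c, acting as x maps to (sum j. c$j * x$j).\<close>

definition fapp :: "'a::field^'n \<Rightarrow> 'a^'n \<Rightarrow> 'a" where
  "fapp c x = (\<Sum>j\<in>UNIV. c$j * x$j)"

text \<open>The matrix of 1 + u (x) phi, i.e. x maps to x + phi(x) u.\<close>
definition transv_mat :: "'a::field^'n \<Rightarrow> 'a^'n \<Rightarrow> 'a^'n^'n" where
  "transv_mat u c = mat 1 + (\<chi> i j. u$i * c$j)"

definition transv_data :: "'a::field^'n^'n \<Rightarrow> 'a^'n \<Rightarrow> 'a^'n \<Rightarrow> bool" where
  "transv_data A u c \<longleftrightarrow> u \<noteq> 0 \<and> c \<noteq> 0 \<and> fapp c u = 0 \<and> A = transv_mat u c"

definition is_transvection :: "'a::field^'n^'n \<Rightarrow> bool" where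
  "is_transvection A \<longleftrightarrow> (\<exists>u c. transv_data A u c)"

text \<open>Chosen representatives u_s and phi_s (determined up to (a u, a^-1 phi)).\<close>
definition tv_u :: "'a::field^'n^'n \<Rightarrow> 'a^'n" where
  "tv_u A = fst (SOME p. transv_data A (fst p) (snd p))"

definition tv_phi :: "'a::field^'n^'n \<Rightarrow> 'a^'n" where
  "tv_phi A = snd (SOME p. transv_data A (fst p) (snd p))"

text \<open>Edge [s,t] of Gamma(Y): phi_t(u_s) \<noteq> 0.\<close>
definition gedge :: "'a::field^'n^'n \<Rightarrow> 'a^'n^'n \<Rightarrow> bool" where
  "gedge s t \<longleftrightarrow> fapp (tv_phi t) (tv_u s) \<noteq> 0"

definition dir_rel :: "('a::field^'n^'n) set \<Rightarrow> (('a^'n^'n) \<times> ('a^'n^'n)) set" where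
  "dir_rel Y = {(s,t). s \<in> Y \<and> t \<in> Y \<and> gedge s t}"

definition twoway_rel :: "('a::field^'n^'n) set \<Rightarrow> (('a^'n^'n) \<times> ('a^'n^'n)) set" where
  "twoway_rel Y = {(s,t). s \<in> Y \<and> t \<in> Y \<and> gedge s t \<and> gedge t s}"

definition strongly_connected :: "('a::field^'n^'n) set \<Rightarrow> bool" where
  "strongly_connected Y \<longleftrightarrow> (\<forall>s\<in>Y. \<forall>t\<in>Y. (s,t) \<in> (dir_rel Y)\<^sup>*)"

text \<open>Diameter of a graph (given by its edge relation R) on vertex set Y is at most k.\<close>
definition diam_le :: "'b set \<Rightarrow> ('b \<times> 'b) set \<Rightarrow> nat \<Rightarrow> bool" where
  "diam_le Y R k \<longleftrightarrow> (\<forall>s\<in>Y. \<forall>t\<in>Y. \<exists>m\<le>k. (s,t) \<in> R ^^ m)"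

text \<open>Weight of a tuple (r_1,...,r_k): prod_i phi_{r_(i+1)}(u_{r_i}), indices mod k.\<close>
definition tweight :: "('a::field^'n^'n) list \<Rightarrow> 'a" where
  "tweight rs = (\<Prod>i<length rs. fapp (tv_phi (rs ! ((i+1) mod length rs))) (tv_u (rs ! i)))"

definition cycle_weights :: "('a::field^'n^'n) set \<Rightarrow> nat \<Rightarrow> 'a set" where
  "cycle_weights Y k = {tweight rs | rs. rs \<noteq> [] \<and> length rs \<le> k \<and> set rs \<subseteq> Y \<and> tweight rs \<noteq> 0}"

definition all_cycle_weights :: "('a::field^'n^'n) set \<Rightarrow> 'a set" where
  "all_cycle_weights Y = {tweight rs | rs. rs \<noteq> [] \<and> set rs \<subseteq> Y \<and> tweight rs \<noteq> 0}"

definition is_subfield :: "'a::field set \<Rightarrow> bool" where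
  "is_subfield K \<longleftrightarrow> 0 \<in> K \<and> 1 \<in> K \<and>
     (\<forall>a\<in>K. \<forall>b\<in>K. a + b \<in> K \<and> a * b \<in> K) \<and> (\<forall>a\<in>K. - a \<in> K \<and> inverse a \<in> K)"

definition gen_subfield :: "'a::field set \<Rightarrow> 'a set" where
  "gen_subfield S = \<Inter>{K. is_subfield K \<and> S \<subseteq> K}"

text \<open>L_k(Y)\<close>
definition Lk :: "nat \<Rightarrow> ('a::field^'n^'n) set \<Rightarrow> 'a set" where
  "Lk k Y = gen_subfield (cycle_weights Y k)"

text \<open>Degree |F : K| of the finite field F = UNIV over a subfield K.\<close>
definition field_index :: "'a::{field,finite} set \<Rightarrow> nat" where
  "field_index K = (THE d. CARD('a) = card K ^ d)"

text \<open>Subgroup generated by a set of invertible matrices.\<close>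
inductive_set gen_group :: "('a::field^'n^'n) set \<Rightarrow> ('a^'n^'n) set" for S where
  one: "mat 1 \<in> gen_group S"
| gen: "A \<in> S \<Longrightarrow> A \<in> gen_group S"
| mult: "A \<in> gen_group S \<Longrightarrow> B \<in> gen_group S \<Longrightarrow> A ** B \<in> gen_group S"
| inv: "A \<in> gen_group S \<Longrightarrow> matrix_inv A \<in> gen_group S"

text \<open>Y^(k): transvections that are products of at most k elements of Y \<union> Y^-1.\<close>
definition Ypow :: "('a::field^'n^'n) set \<Rightarrow> nat \<Rightarrow> ('a^'n^'n) set" where
  "Ypow Y k = {A. is_transvection A \<and>
     (\<exists>ws. length ws \<le> k \<and> set ws \<subseteq> Y \<union> matrix_inv ` Y \<and> A = foldr (**) ws (mat 1))}"

text \<open>Forms on V.\<close>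
definition alternating_form :: "('a::field^'n \<Rightarrow> 'a^'n \<Rightarrow> 'a) \<Rightarrow> bool" where
  "alternating_form B \<longleftrightarrow>
     (\<forall>x y z. B (x + y) z = B x z + B y z) \<and> (\<forall>a x z. B (a *s x) z = a * B x z) \<and>
     (\<forall>x y z. B z (x + y) = B z x + B z y) \<and> (\<forall>a x z. B z (a *s x) = a * B z x) \<and>
     (\<forall>x. B x x = 0) \<and> (\<forall>x. (\<forall>y. B x y = 0) \<longrightarrow> x = 0)"

definition field_involution :: "('a::field \<Rightarrow> 'a) \<Rightarrow> bool" where
  "field_involution \<sigma> \<longleftrightarrow> (\<forall>a b. \<sigma> (a + b) = \<sigma> a + \<sigma> b \<and> \<sigma> (a * b) = \<sigma> a * \<sigma> b) \<and>
     (\<forall>a. \<sigma> (\<sigma> a) = a) \<and> (\<exists>a. \<sigma> a \<noteq> a)"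

definition hermitian_form :: "('a::field \<Rightarrow> 'a) \<Rightarrow> ('a^'n \<Rightarrow> 'a^'n \<Rightarrow> 'a) \<Rightarrow> bool" where
  "hermitian_form \<sigma> B \<longleftrightarrow> field_involution \<sigma> \<and>
     (\<forall>x y z. B (x + y) z = B x z + B y z) \<and> (\<forall>a x z. B (a *s x) z = a * B x z) \<and>
     (\<forall>x y. B y x = \<sigma> (B x y)) \<and> (\<forall>x. (\<forall>y. B x y = 0) \<longrightarrow> x = 0)"

definition isometries :: "('a::field^'n \<Rightarrow> 'a^'n \<Rightarrow> 'a) \<Rightarrow> ('a^'n^'n) set" where
  "isometries B = {A. \<forall>x y. B (A *v x) (A *v y) = B x y}"

definition Sp :: "('a::field^'n \<Rightarrow> 'a^'n \<Rightarrow> 'a) \<Rightarrow> ('a^'n^'n) set" where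
  "Sp B = isometries B"

definition SU :: "('a::field^'n \<Rightarrow> 'a^'n \<Rightarrow> 'a) \<Rightarrow> ('a^'n^'n) set" where
  "SU B = {A \<in> isometries B. det A = 1}"

definition transvections_of :: "('a::field^'n^'n) set \<Rightarrow> ('a^'n^'n) set" where
  "transvections_of G = {A \<in> G. is_transvection A}"

end

theory Submission
  imports Defs
begin

text \<open>
  A transvection x \<mapsto> x + \<phi>(x) u preserving the form has \<phi> = \<kappa> B(u, -) in the symplectic case
  and \<phi> = \<kappa> B(-, u) with \<sigma>(\<kappa>) = -\<kappa> in the unitary case. In the unitary case this makes every
  2-cycle weight \<phi>_t(u_s) \<phi>_s(u_t) invariant under \<sigma>, so L_2(X) lies in the fixed field \<bbbF>_q_0
  of \<sigma>; as \<bbbF>_q_0 \<noteq> \<bbbF>_q and |\<bbbF>_q : L_2(X)| \<le> 2, the two fields coincide.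
  In the symplectic case, reversing a 3-cycle changes the sign of its weight. For r, s, t \<in> X
  the conjugate r s r^-1 is a transvection in X^(3), and the weight of the 2-cycle (r s r^-1, t)
  is w(s, t) + 2 w(s, r, t) - w(s, r) w(r, t). As q is odd, every cycle weight of length at most 3
  of X lies in L_2(X^(3)), which therefore contains L_3(X) = \<bbbF>_q.
\<close>

lemma of_nat_CARD_eq_0: "of_nat CARD('a) = (0::'a::{ring_1,finite})"
proof -
  have "(\<Sum>x\<in>UNIV. x + 1) = (\<Sum>x\<in>(UNIV::'a set). x)"
    by (rule sum.reindex_bij_witness[where i = "\<lambda>x. x - 1" and j = "\<lambda>x. x + 1"]) auto
  then show ?thesis
    by (simp add: sum.distrib)
qed

lemma two_neq_zero_if_odd_CARD:
  assumes "odd CARD('a::{ring_1,finite})"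
  shows "(2::'a) \<noteq> 0"
proof
  assume two: "(2::'a) = 0"
  obtain k where "CARD('a) = 2 * k + 1"
    using assms oddE by blast
  then have "of_nat CARD('a) = 2 * of_nat k + (1::'a)"
    by simp
  then show False
    using two by (simp add: of_nat_CARD_eq_0)
qed

section \<open>Linear functionals and transvection matrices\<close>

lemma fapp_add [simp]: "fapp c (x + y) = fapp c x + fapp c y"
  by (simp add: fapp_def algebra_simps sum.distrib)

lemma fapp_scale [simp]: "fapp c (k *s x) = k * fapp c x"
  by (simp add: fapp_def algebra_simps sum_distrib_left)

lemma fapp_add_left [simp]: "fapp (c + d) x = fapp c x + fapp d x"
  by (simp add: fapp_def algebra_simps sum.distrib)

lemma fapp_scale_left [simp]: "fapp (k *s c) x = k * fapp c x"
  by (simp add: fapp_def algebra_simps sum_distrib_left)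

lemma fapp_diff_left [simp]: "fapp (c - d) x = fapp c x - fapp d x"
  by (simp add: fapp_def algebra_simps sum_subtractf)

lemma fapp_minus_left [simp]: "fapp (- c) x = - fapp c x"
  by (simp add: fapp_def sum_negf)

lemma fapp_0_left [simp]: "fapp 0 x = 0"
  by (simp add: fapp_def)

lemma fapp_eq_0_iff: "(\<forall>x. fapp c x = 0) \<longleftrightarrow> c = 0"
proof
  assume vanish: "\<forall>x. fapp c x = 0"
  have "fapp c (axis j 1) = c $ j" for j
    by (simp add: fapp_def axis_def if_distrib cong: if_cong)
  then show "c = 0"
    using vanish by (simp add: vec_eq_iff)
qed simp

lemma transv_mat_apply: "transv_mat u c *v x = x + fapp c x *s u"
proof -
  have "(\<chi> i j. u$i * c$j) *v x = fapp c x *s u"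
    by (simp add: fapp_def vec_eq_iff matrix_vector_mult_def sum_distrib_left algebra_simps)
  then show ?thesis
    by (simp add: transv_mat_def matrix_vector_mult_add_rdistrib)
qed

lemma transv_mat_mult_same_u:
  assumes "fapp c u = 0"
  shows "transv_mat u c ** transv_mat u d = transv_mat u (c + d)"
  unfolding matrix_eq
  by (simp add: matrix_vector_mul_assoc[symmetric] transv_mat_apply assms algebra_simps
      vector_sadd_rdistrib)

lemma transv_mat_0: "transv_mat u 0 = mat 1"
  by (simp add: matrix_eq transv_mat_apply)

lemma matrix_inv_eqI:
  fixes A :: "'a::field^'n^'n"
  assumes "A ** A' = mat 1" "A' ** A = mat 1"
  shows "matrix_inv A = A'"
proof -
  have "A ** matrix_inv A = mat 1 \<and> matrix_inv A ** A = mat 1"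
    unfolding matrix_inv_def by (rule someI[of _ A']) (use assms in blast)
  then have "matrix_inv A = matrix_inv A ** (A ** A')"
    using assms by simp
  also have "\<dots> = A'"
    by (simp add: matrix_mul_assoc \<open>_ \<and> _\<close>)
  finally show ?thesis .
qed

lemma matrix_inv_transv_mat:
  assumes "fapp c u = 0"
  shows "matrix_inv (transv_mat u c) = transv_mat u (- c)"
  by (rule matrix_inv_eqI) (simp_all add: assms transv_mat_mult_same_u transv_mat_0)

lemma transv_data_tv:
  assumes "is_transvection A"
  shows "transv_data A (tv_u A) (tv_phi A)"
  using assms unfolding is_transvection_def tv_u_def tv_phi_def
  by (rule someI_ex[where P = "\<lambda>p. transv_data A (fst p) (snd p)", simplified])

text \<open>Weights do not depend on the choice of the representatives u_s, \<phi>_s.\<close>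
lemma transv_mat_eq_fapp_mult:
  assumes "transv_mat u c = transv_mat u' c'"
  shows "fapp d u * fapp c y = fapp d u' * fapp c' y"
proof -
  have "fapp c y *s u = fapp c' y *s u'"
    using arg_cong[OF assms, of "\<lambda>A. A *v y"] by (simp add: transv_mat_apply)
  then have "fapp d (fapp c y *s u) = fapp d (fapp c' y *s u')"
    by (rule arg_cong)
  then show ?thesis
    by (simp add: mult.commute)
qed

lemma transv_data_conj:
  assumes r: "transv_data r a \<alpha>" and s: "transv_data s b \<beta>"
  defines "c' \<equiv> \<beta> - fapp \<beta> a *s \<alpha>"
  shows "transv_data (r ** s ** matrix_inv r) (r *v b) c'"
proof -
  have r_eq: "r = transv_mat a \<alpha>" and \<alpha>a: "fapp \<alpha> a = 0"
    using r by (auto simp: transv_data_def)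
  have s_eq: "s = transv_mat b \<beta>" and \<beta>b: "fapp \<beta> b = 0" and "b \<noteq> 0" "\<beta> \<noteq> 0"
    using s by (auto simp: transv_data_def)
  have r_inv: "matrix_inv r = transv_mat a (- \<alpha>)"
    using \<alpha>a by (simp add: r_eq matrix_inv_transv_mat)
  have r_inv_r: "matrix_inv r *v (r *v y) = y" and r_r_inv: "r *v (matrix_inv r *v y) = y" for y
    unfolding r_inv matrix_vector_mul_assoc
    using \<alpha>a by (simp_all add: r_eq transv_mat_mult_same_u transv_mat_0)
  have c'_r: "fapp c' (r *v y) = fapp \<beta> y" for y
    using \<alpha>a by (simp add: c'_def r_eq transv_mat_apply algebra_simps)
  have "(r ** s ** matrix_inv r) *v (r *v y) = r *v y + fapp c' (r *v y) *s (r *v b)" for y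
    by (simp add: matrix_vector_mul_assoc[symmetric] r_inv_r c'_r s_eq transv_mat_apply
        matrix_vector_right_distrib vector_scalar_commute)
  then have "r ** s ** matrix_inv r = transv_mat (r *v b) c'"
    unfolding matrix_eq transv_mat_apply by (metis r_r_inv)
  moreover have "r *v b \<noteq> 0"
    using r_inv_r[of b] \<open>b \<noteq> 0\<close> by auto
  moreover have "c' \<noteq> 0"
    using c'_r \<open>\<beta> \<noteq> 0\<close> fapp_eq_0_iff by (metis fapp_0_left)
  moreover have "fapp c' (r *v b) = 0"
    using c'_r \<beta>b by simp
  ultimately show ?thesis
    by (simp add: transv_data_def)
qed

section \<open>Transvections preserving a form\<close>

lemma alternating_form_bilinear:
  assumes "alternating_form B"
  shows "B (x + y) z = B x z + B y z" "B (a *s x) z = a * B x z"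
    and "B z (x + y) = B z x + B z y" "B z (a *s x) = a * B z x" "B x x = 0"
  using assms unfolding alternating_form_def by fast+

lemma alternating_form_skew:
  assumes "alternating_form B"
  shows "B x y = - B y x"
proof -
  note B = alternating_form_bilinear[OF assms]
  have "B (x + y) (x + y) = 0"
    by (rule B(5))
  then have "B x x + B y x + (B x y + B y y) = 0"
    by (simp only: B(1,3))
  then have "B x y + B y x = 0"
    by (simp add: B(5) add.commute)
  then show ?thesis
    by (simp add: eq_neg_iff_add_eq_0)
qed

lemma sp_transvection_functional:
  assumes alt: "alternating_form B" and iso: "A \<in> isometries B" and A: "transv_data A u c"
  obtains \<kappa> where "\<And>x. fapp c x = \<kappa> * B u x"
proof -
  have A_eq: "A = transv_mat u c" and "u \<noteq> 0"
    using A by (auto simp: transv_data_def)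
  have isom: "fapp c y * B x u + fapp c x * B u y = 0" for x y
  proof -
    have "B (A *v x) (A *v y) = B x y"
      using iso by (simp add: isometries_def)
    then show ?thesis
      by (simp add: alternating_form_bilinear[OF alt] A_eq transv_mat_apply algebra_simps)
  qed
  obtain y0 where y0: "B u y0 \<noteq> 0"
    using alt \<open>u \<noteq> 0\<close> unfolding alternating_form_def by blast
  have "fapp c x = (fapp c y0 / B u y0) * B u x" for x
  proof -
    have "fapp c x * B u y0 = - (fapp c y0 * B x u)"
      using isom[where x = x and y = y0] by (simp add: eq_neg_iff_add_eq_0 add.commute)
    also have "\<dots> = fapp c y0 * B u x"
      using alternating_form_skew[OF alt, of x u] by simp
    finally have "fapp c x * B u y0 = fapp c y0 * B u x" .
    then show ?thesis
      using y0 by (simp add: field_simps)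
  qed
  then show ?thesis
    using that by blast
qed

lemma field_involution_simps:
  assumes "field_involution \<sigma>"
  shows "\<sigma> (a + b) = \<sigma> a + \<sigma> b" "\<sigma> (a * b) = \<sigma> a * \<sigma> b" "\<sigma> (\<sigma> a) = a"
    and "\<sigma> 0 = 0" "\<sigma> 1 = 1" "\<sigma> (- a) = - \<sigma> a" "\<sigma> (inverse a) = inverse (\<sigma> a)"
    and "\<sigma> a = 0 \<longleftrightarrow> a = 0"
proof -
  show add: "\<sigma> (a + b) = \<sigma> a + \<sigma> b" and mult: "\<sigma> (a * b) = \<sigma> a * \<sigma> b"
    and invol: "\<sigma> (\<sigma> a) = a" for a b
    using assms by (simp_all add: field_involution_def)
  show zero: "\<sigma> 0 = 0"
    using add[of 0 0] by (metis add_cancel_right_right)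
  show eq_0: "\<sigma> a = 0 \<longleftrightarrow> a = 0" for a
    by (metis invol zero)
  show "\<sigma> 1 = 1"
    using mult[of 1 1] eq_0[of 1] by simp
  show "\<sigma> (- a) = - \<sigma> a"
    using add[of a "- a"] zero by (metis add.commute eq_neg_iff_add_eq_0 add.right_inverse)
  show "\<sigma> (inverse a) = inverse (\<sigma> a)"
    using mult[of a "inverse a"] \<open>\<sigma> 1 = 1\<close> zero
    by (cases "a = 0") (simp_all add: inverse_unique)
qed

lemma hermitian_form_sesquilinear:
  assumes "hermitian_form \<sigma> B"
  shows "B (x + y) z = B x z + B y z" "B (a *s x) z = a * B x z"
    and "B z (x + y) = B z x + B z y" "B z (a *s x) = \<sigma> a * B z x"
proof -
  have inv: "field_involution \<sigma>" and B_sym: "\<And>x y. B y x = \<sigma> (B x y)"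
    and left: "\<And>x y z. B (x + y) z = B x z + B y z" "\<And>a x z. B (a *s x) z = a * B x z"
    using assms unfolding hermitian_form_def by fast+
  show "B (x + y) z = B x z + B y z" "B (a *s x) z = a * B x z"
    by (fact left)+
  have "B z (x + y) = \<sigma> (B x z + B y z)"
    by (simp only: B_sym[where x = "x + y" and y = z] left)
  then show "B z (x + y) = B z x + B z y"
    by (simp only: field_involution_simps(1)[OF inv] B_sym[symmetric])
  have "B z (a *s x) = \<sigma> (a * B x z)"
    by (simp only: B_sym[where x = "a *s x" and y = z] left)
  then show "B z (a *s x) = \<sigma> a * B z x"
    by (simp only: field_involution_simps(2)[OF inv] B_sym[symmetric])
qed

lemma su_transvection_isometry_identity:
  assumes herm: "hermitian_form \<sigma> B" and iso: "A \<in> isometries B" and A: "transv_data A u c"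
  shows "\<sigma> (fapp c y) * B x u + fapp c x * B u y = 0"
proof -
  have "field_involution \<sigma>"
    using herm unfolding hermitian_form_def by fast
  note \<sigma>_eq_0 = field_involution_simps(8)[OF this]
  have A_eq: "A = transv_mat u c" and "c \<noteq> 0" and cu: "fapp c u = 0"
    using A by (auto simp: transv_data_def)
  have isom: "\<sigma> (fapp c y) * B x u + fapp c x * B u y + fapp c x * \<sigma> (fapp c y) * B u u = 0"
    for x y
  proof -
    have "B (A *v x) (A *v y) = B x y"
      using iso by (simp add: isometries_def)
    then show ?thesis
      by (simp add: hermitian_form_sesquilinear[OF herm] A_eq transv_mat_apply algebra_simps)
  qed
  obtain y1 where "fapp c y1 \<noteq> 0"
    using \<open>c \<noteq> 0\<close> fapp_eq_0_iff by blast
  then have "B u u = 0"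
    using isom[where x = u and y = y1] cu \<sigma>_eq_0 by simp
  then show ?thesis
    using isom[where x = x and y = y] by simp
qed

lemma su_transvection_functional:
  assumes herm: "hermitian_form \<sigma> B" and iso: "A \<in> isometries B" and A: "transv_data A u c"
  obtains \<kappa> where "\<sigma> \<kappa> = - \<kappa>" "\<And>x. fapp c x = \<kappa> * B x u"
proof -
  have inv: "field_involution \<sigma>" and B_sym: "\<And>x y. B y x = \<sigma> (B x y)"
    using herm unfolding hermitian_form_def by fast+
  note \<sigma> = field_involution_simps[OF inv]
  note isom = su_transvection_isometry_identity[OF assms]
  have "u \<noteq> 0"
    using A by (simp add: transv_data_def)
  then obtain y0 where y0: "B u y0 \<noteq> 0"
    using herm unfolding hermitian_form_def by blast
  define \<kappa> where "\<kappa> = - \<sigma> (fapp c y0) / B u y0"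
  have \<kappa>: "fapp c x = \<kappa> * B x u" for x
  proof -
    have "fapp c x * B u y0 = - \<sigma> (fapp c y0) * B x u"
      using isom[where x = x and y = y0] by (simp add: add_eq_0_iff2 algebra_simps)
    then show ?thesis
      using y0 by (simp add: \<kappa>_def field_simps)
  qed
  have "B y0 u \<noteq> 0"
    using y0 B_sym[of u y0] \<sigma>(8) by simp
  have "\<sigma> (\<kappa> * B y0 u) * B y0 u + \<kappa> * B y0 u * B u y0 = 0"
    using isom[where x = y0 and y = y0] by (simp add: \<kappa>)
  then have "(\<sigma> \<kappa> + \<kappa>) * (B y0 u * B u y0) = 0"
    using B_sym[of y0 u] by (simp add: \<sigma>(2,3) algebra_simps)
  then have "\<sigma> \<kappa> = - \<kappa>"
    using y0 \<open>B y0 u \<noteq> 0\<close> by (simp add: eq_neg_iff_add_eq_0)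
  then show ?thesis
    using that \<kappa> by blast
qed

section \<open>Subfields of a finite field\<close>

lemma is_subfield_gen_subfield: "is_subfield (gen_subfield S)"
  unfolding gen_subfield_def is_subfield_def by auto

lemma subset_gen_subfield: "S \<subseteq> gen_subfield S"
  unfolding gen_subfield_def by auto

lemma gen_subfield_least: "is_subfield K \<Longrightarrow> S \<subseteq> K \<Longrightarrow> gen_subfield S \<subseteq> K"
  unfolding gen_subfield_def by auto

lemma is_subfield_UNIV: "is_subfield UNIV"
  by (simp add: is_subfield_def)

lemma is_subfield_fixed_field:
  assumes "field_involution \<sigma>"
  shows "is_subfield {a. \<sigma> a = a}"
  using field_involution_simps[OF assms] by (simp add: is_subfield_def)

lemma subfield_closed:
  assumes "is_subfield K"
  shows "0 \<in> K" "1 \<in> K" "a \<in> K \<Longrightarrow> b \<in> K \<Longrightarrow> a + b \<in> K" "a \<in> K \<Longrightarrow> b \<in> K \<Longrightarrow> a * b \<in> K"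
    and "a \<in> K \<Longrightarrow> - a \<in> K" "a \<in> K \<Longrightarrow> inverse a \<in> K" "a \<in> K \<Longrightarrow> b \<in> K \<Longrightarrow> a - b \<in> K"
  using assms unfolding is_subfield_def diff_conv_add_uminus by blast+

lemma two_le_card_subfield:
  fixes K :: "'a::{field,finite} set"
  assumes "is_subfield K"
  shows "2 \<le> card K"
proof -
  have "card {0::'a, 1} \<le> card K"
    using subfield_closed(1,2)[OF assms] by (intro card_mono) auto
  then show ?thesis
    by simp
qed

definition subspace_over :: "'a::field set \<Rightarrow> 'a set \<Rightarrow> bool" where
  "subspace_over K W \<longleftrightarrow> 0 \<in> W \<and> (\<forall>a\<in>W. \<forall>b\<in>W. a + b \<in> W) \<and> (\<forall>k\<in>K. \<forall>a\<in>W. k * a \<in> W)"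

lemma subspace_over_extend:
  assumes K: "is_subfield K" and W: "subspace_over K W"
  shows "subspace_over K ((\<lambda>(w, k). w + k * x) ` (W \<times> K))" (is "subspace_over K ?W'")
proof -
  note K_closed = subfield_closed[OF K]
  have W_closed: "0 \<in> W" "\<And>a b. a \<in> W \<Longrightarrow> b \<in> W \<Longrightarrow> a + b \<in> W"
    "\<And>k a. k \<in> K \<Longrightarrow> a \<in> W \<Longrightarrow> k * a \<in> W"
    using W by (auto simp: subspace_over_def)
  have mem_W': "y \<in> ?W' \<longleftrightarrow> (\<exists>w\<in>W. \<exists>k\<in>K. y = w + k * x)" for y
    by auto
  show ?thesis
    unfolding subspace_over_def
  proof (intro conjI ballI)
    show "0 \<in> ?W'"
      unfolding mem_W' using W_closed(1) K_closed(1) by force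
  next
    fix a b assume "a \<in> ?W'" "b \<in> ?W'"
    then obtain wa ka wb kb where "wa \<in> W" "ka \<in> K" "wb \<in> W" "kb \<in> K"
      and "a = wa + ka * x" "b = wb + kb * x"
      unfolding mem_W' by blast
    then show "a + b \<in> ?W'"
      unfolding mem_W' using W_closed(2) K_closed(3)
      by (intro bexI[of _ "wa + wb"] bexI[of _ "ka + kb"]) (auto simp: algebra_simps)
  next
    fix c a assume "c \<in> K" "a \<in> ?W'"
    then obtain w k where "w \<in> W" "k \<in> K" "a = w + k * x"
      unfolding mem_W' by blast
    then show "c * a \<in> ?W'"
      unfolding mem_W' using W_closed(3) K_closed(4) \<open>c \<in> K\<close>
      by (intro bexI[of _ "c * w"] bexI[of _ "c * k"]) (auto simp: algebra_simps)
  qed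
qed

lemma inj_on_extend_subspace_over:
  assumes K: "is_subfield K" and W: "subspace_over K W" and "x \<notin> W"
  shows "inj_on (\<lambda>(w, k). w + k * x) (W \<times> K)"
proof (rule inj_onI, clarsimp)
  note K_closed = subfield_closed[OF K]
  have W_closed: "\<And>a b. a \<in> W \<Longrightarrow> b \<in> W \<Longrightarrow> a + b \<in> W"
    "\<And>k a. k \<in> K \<Longrightarrow> a \<in> W \<Longrightarrow> k * a \<in> W"
    using W by (auto simp: subspace_over_def)
  fix w k w' k'
  assume "w \<in> W" "k \<in> K" "w' \<in> W" "k' \<in> K" and eq: "w + k * x = w' + k' * x"
  show "w = w' \<and> k = k'"
  proof (cases "k = k'")
    case False
    have "-1 * w \<in> W"
      using W_closed(2) K_closed(2,5) \<open>w \<in> W\<close> by blast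
    then have "inverse (k - k') * (w' + -1 * w) \<in> W"
      using W_closed K_closed(6,7) \<open>w' \<in> W\<close> \<open>k \<in> K\<close> \<open>k' \<in> K\<close> by blast
    moreover have "inverse (k - k') * (w' + -1 * w) = x"
      using eq False by (simp add: field_simps)
    ultimately show ?thesis
      using \<open>x \<notin> W\<close> by simp
  qed (use eq in simp)
qed

lemma card_subspace_over:
  fixes K W U :: "'a::{field,finite} set"
  assumes K: "is_subfield K" and "subspace_over K W" "subspace_over K U" "W \<subseteq> U"
  shows "\<exists>f. card U = card W * card K ^ f"
  using assms(2-4)
proof (induction "card (U - W)" arbitrary: W rule: less_induct)
  case less
  show ?case
  proof (cases "W = U")
    case False
    then obtain x where "x \<in> U" "x \<notin> W"
      using less.prems(3) by blast
    define W' where "W' = (\<lambda>(w, k). w + k * x) ` (W \<times> K)"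
    have W': "subspace_over K W'" "card W' = card W * card K"
      using subspace_over_extend[OF K less.prems(1)]
        inj_on_extend_subspace_over[OF K less.prems(1) \<open>x \<notin> W\<close>]
      by (simp_all add: W'_def card_image card_cartesian_product)
    have "W' \<subseteq> U"
      using less.prems \<open>x \<in> U\<close> by (auto simp: W'_def subspace_over_def)
    moreover have "W \<subseteq> W'" "x \<in> W'"
      using less.prems(1) subfield_closed(1,2)[OF K] by (force simp: W'_def subspace_over_def)+
    ultimately have "card (U - W') < card (U - W)"
      using \<open>x \<notin> W\<close> by (intro psubset_card_mono) auto
    then obtain f where "card U = card W' * card K ^ f"
      using less.hyps W'(1) less.prems(2) \<open>W' \<subseteq> U\<close> by blast
    then show ?thesis
      using W'(2) by (metis mult.assoc power_Suc)
  qed (metis mult.right_neutral power_0)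
qed

lemma card_subfield_power:
  fixes K L :: "'a::{field,finite} set"
  assumes "is_subfield K" "is_subfield L" "K \<subseteq> L"
  shows "\<exists>f. card L = card K ^ f"
proof -
  have "subspace_over K {0}" "subspace_over K L" "{0} \<subseteq> L"
    using assms subfield_closed[OF assms(2)] by (auto simp: subspace_over_def)
  then show ?thesis
    using card_subspace_over[OF assms(1)] by fastforce
qed

lemma CARD_eq_card_power_field_index:
  fixes K :: "'a::{field,finite} set"
  assumes "is_subfield K"
  shows "CARD('a) = card K ^ field_index K"
proof -
  obtain d where d: "CARD('a) = card K ^ d"
    using card_subfield_power[OF assms is_subfield_UNIV] by auto
  have "field_index K = d"
    unfolding field_index_def
  proof (rule the_equality)
    fix d' assume "CARD('a) = card K ^ d'"
    then show "d' = d"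
      using d two_le_card_subfield[OF assms] by (simp add: power_inject_exp)
  qed (fact d)
  then show ?thesis
    using d by simp
qed

lemma subfield_eq_or_UNIV_if_field_index_le_2:
  fixes K L :: "'a::{field,finite} set"
  assumes K: "is_subfield K" and L: "is_subfield L" and "K \<subseteq> L" and "field_index K \<le> 2"
  shows "K = L \<or> L = UNIV"
proof -
  obtain f where f: "card L = card K ^ f"
    using card_subfield_power[OF K L \<open>K \<subseteq> L\<close>] by blast
  have g: "CARD('a) = card L ^ field_index L"
    by (rule CARD_eq_card_power_field_index[OF L])
  have "card K ^ field_index K = card K ^ (f * field_index L)"
    using CARD_eq_card_power_field_index[OF K] f g by (simp add: power_mult)
  then have "field_index K = f * field_index L"
    using two_le_card_subfield[OF K] by (simp add: power_inject_exp)
  moreover have "f \<noteq> 0"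
    using f two_le_card_subfield[OF L] by (cases f) auto
  moreover have "field_index L \<noteq> 0"
    using g two_le_card_subfield[OF is_subfield_UNIV[where 'a = 'a]] by (cases "field_index L") auto
  ultimately have "f = 1 \<or> field_index L = 1"
    using \<open>field_index K \<le> 2\<close> by (cases f; cases "field_index L") auto
  then show ?thesis
  proof
    assume "f = 1"
    then show ?thesis
      using f \<open>K \<subseteq> L\<close> by (simp add: card_subset_eq)
  next
    assume "field_index L = 1"
    then show ?thesis
      using g by (simp add: card_subset_eq)
  qed
qed

section \<open>Cycle weights\<close>

abbreviation edge_weight :: "'a::field^'n^'n \<Rightarrow> 'a^'n^'n \<Rightarrow> 'a" where
  "edge_weight s t \<equiv> fapp (tv_phi t) (tv_u s)"

lemma tweight_singleton: "tweight [s] = edge_weight s s"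
  by (simp add: tweight_def)

lemma tweight_pair: "tweight [s, t] = edge_weight s t * edge_weight t s"
proof -
  have "{..<length [s, t]} = {0, 1}"
    by auto
  then show ?thesis
    by (simp add: tweight_def)
qed

lemma tweight_triple: "tweight [s, r, t] = edge_weight s r * edge_weight r t * edge_weight t s"
proof -
  have "{..<length [s, r, t]} = {0, 1, 2}"
    by auto
  then show ?thesis
    by (simp add: tweight_def mult.assoc)
qed

lemma tweight_singleton_eq_0:
  assumes "is_transvection s"
  shows "tweight [s] = 0"
  using transv_data_tv[OF assms] by (simp add: tweight_singleton transv_data_def)

lemma is_subfield_Lk: "is_subfield (Lk k Y)"
  by (simp add: Lk_def is_subfield_gen_subfield)

lemma tweight_mem_Lk:
  assumes "rs \<noteq> []" "length rs \<le> k" "set rs \<subseteq> Y"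
  shows "tweight rs \<in> Lk k Y"
proof (cases "tweight rs = 0")
  case True
  then show ?thesis
    using subfield_closed(1)[OF is_subfield_Lk] by simp
next
  case False
  then have "tweight rs \<in> cycle_weights Y k"
    using assms by (auto simp: cycle_weights_def)
  then show ?thesis
    using subset_gen_subfield by (auto simp: Lk_def)
qed

lemma cycle_weights_le_3_cases [consumes 2, case_names singleton pair triple]:
  assumes "w \<in> cycle_weights Y k" "k \<le> 3"
  obtains s where "s \<in> Y" "w = tweight [s]" "w \<noteq> 0"
  | s t where "s \<in> Y" "t \<in> Y" "w = tweight [s, t]"
  | s r t where "k = 3" "s \<in> Y" "r \<in> Y" "t \<in> Y" "w = tweight [s, r, t]"
proof -
  obtain rs where rs: "w = tweight rs" "rs \<noteq> []" "length rs \<le> k" "set rs \<subseteq> Y" "w \<noteq> 0"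
    using assms(1) by (auto simp: cycle_weights_def)
  have "length rs \<in> {1, 2, 3}" "length rs = 3 \<Longrightarrow> k = 3"
    using rs(2,3) assms(2) by (auto simp flip: length_greater_0_conv)
  then show ?thesis
    using that rs by (auto simp: length_Suc_conv numeral_2_eq_2 numeral_3_eq_3)
qed

lemma tweight_conj:
  assumes r: "is_transvection r" and s: "is_transvection s"
  shows "is_transvection (r ** s ** matrix_inv r)"
    and "tweight [r ** s ** matrix_inv r, t]
      = tweight [s, t] + tweight [s, r, t] - tweight [s, t, r] - tweight [s, r] * tweight [r, t]"
proof -
  let ?s' = "r ** s ** matrix_inv r"
  define c' where "c' = tv_phi s - fapp (tv_phi s) (tv_u r) *s tv_phi r"
  have conj: "transv_data ?s' (r *v tv_u s) c'"
    unfolding c'_def by (rule transv_data_conj[OF transv_data_tv[OF r] transv_data_tv[OF s]])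
  then show s': "is_transvection ?s'"
    by (auto simp: is_transvection_def)
  have "transv_mat (tv_u ?s') (tv_phi ?s') = transv_mat (r *v tv_u s) c'"
    using transv_data_tv[OF s'] conj by (simp add: transv_data_def)
  from transv_mat_eq_fapp_mult[OF this, of "tv_phi t" "tv_u t"]
  have tw: "tweight [?s', t] = fapp (tv_phi t) (r *v tv_u s) * fapp c' (tv_u t)"
    by (simp add: tweight_pair)
  have r_apply: "r *v x = x + fapp (tv_phi r) x *s tv_u r" for x
    using transv_data_tv[OF r] transv_mat_apply unfolding transv_data_def by metis
  show "tweight [?s', t]
      = tweight [s, t] + tweight [s, r, t] - tweight [s, t, r] - tweight [s, r] * tweight [r, t]"
    unfolding tw r_apply c'_def by (simp add: tweight_pair tweight_triple algebra_simps)
qed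

lemma transvections_of_isometriesD:
  assumes "s \<in> transvections_of (isometries B)"
  shows "s \<in> isometries B" "transv_data s (tv_u s) (tv_phi s)"
  using assms transv_data_tv by (auto simp: transvections_of_def)

text \<open>With \<phi>_p = \<kappa>_p B(u_p, -), each edge weight is a skew-symmetric value of B times a
  scalar attached to its head, so reversing a 3-cycle multiplies its weight by (-1)^3.\<close>
lemma sp_tweight_reverse:
  assumes alt: "alternating_form B"
    and X: "{r, s, t} \<subseteq> transvections_of (isometries B)"
  shows "tweight [s, t, r] = - tweight [s, r, t]"
proof -
  have "\<exists>\<kappa>. \<forall>x. fapp (tv_phi p) x = \<kappa> * B (tv_u p) x" if "p \<in> {r, s, t}" for p
    using sp_transvection_functional[OF alt transvections_of_isometriesD[OF subsetD[OF X that]]]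
    by metis
  then obtain \<kappa>r \<kappa>s \<kappa>t where
    \<kappa>: "\<And>x. fapp (tv_phi r) x = \<kappa>r * B (tv_u r) x" "\<And>x. fapp (tv_phi s) x = \<kappa>s * B (tv_u s) x"
      "\<And>x. fapp (tv_phi t) x = \<kappa>t * B (tv_u t) x"
    by (metis insertI1 insertI2)
  have skew: "B (tv_u s) (tv_u t) = - B (tv_u t) (tv_u s)" "B (tv_u s) (tv_u r) = - B (tv_u r) (tv_u s)"
    "B (tv_u r) (tv_u t) = - B (tv_u t) (tv_u r)"
    by (rule alternating_form_skew[OF alt])+
  show ?thesis
    by (simp add: tweight_triple \<kappa> skew)
qed

lemma su_tweight_pair_fixed:
  assumes herm: "hermitian_form \<sigma> B"
    and s: "s \<in> transvections_of (isometries B)" and t: "t \<in> transvections_of (isometries B)"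
  shows "\<sigma> (tweight [s, t]) = tweight [s, t]"
proof -
  have inv: "field_involution \<sigma>" and B_sym: "B y x = \<sigma> (B x y)" for x y
    using herm unfolding hermitian_form_def by fast+
  obtain \<kappa>s where \<kappa>s: "\<sigma> \<kappa>s = - \<kappa>s" "\<And>x. fapp (tv_phi s) x = \<kappa>s * B x (tv_u s)"
    using su_transvection_functional[OF herm transvections_of_isometriesD[OF s]] by blast
  obtain \<kappa>t where \<kappa>t: "\<sigma> \<kappa>t = - \<kappa>t" "\<And>x. fapp (tv_phi t) x = \<kappa>t * B x (tv_u t)"
    using su_transvection_functional[OF herm transvections_of_isometriesD[OF t]] by blast
  have "tweight [s, t] = \<kappa>t * \<kappa>s * (B (tv_u s) (tv_u t) * \<sigma> (B (tv_u s) (tv_u t)))"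
    by (simp add: tweight_pair \<kappa>s(2) \<kappa>t(2) B_sym[where x = "tv_u s" and y = "tv_u t"] mult_ac)
  then show ?thesis
    by (simp add: field_involution_simps[OF inv] \<kappa>s(1) \<kappa>t(1) mult_ac)
qed

lemma subset_Ypow:
  assumes "X \<subseteq> transvections_of G" "1 \<le> k"
  shows "X \<subseteq> Ypow X k"
proof
  fix s assume "s \<in> X"
  then show "s \<in> Ypow X k"
    using assms unfolding Ypow_def transvections_of_def
    by (intro CollectI conjI exI[of _ "[s]"]) auto
qed

lemma conj_mem_Ypow_3:
  assumes "X \<subseteq> transvections_of G" "r \<in> X" "s \<in> X"
  shows "r ** s ** matrix_inv r \<in> Ypow X 3"
proof -
  have "is_transvection r" "is_transvection s"
    using assms by (auto simp: transvections_of_def)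
  then show ?thesis
    using assms(2,3) tweight_conj(1) unfolding Ypow_def
    by (intro CollectI conjI exI[of _ "[r, s, matrix_inv r]"]) (auto simp: matrix_mul_assoc)
qed

lemma sp_tweight_triple_mem_Lk_2_Ypow_3:
  fixes B :: "'a::field^'n \<Rightarrow> 'a^'n \<Rightarrow> 'a"
  assumes alt: "alternating_form B" and X: "X \<subseteq> transvections_of (isometries B)"
    and two: "(2::'a) \<noteq> 0" and "r \<in> X" "s \<in> X" "t \<in> X"
  shows "tweight [s, r, t] \<in> Lk 2 (Ypow X 3)"
proof -
  let ?L = "Lk 2 (Ypow X 3)"
  note L = subfield_closed[OF is_subfield_Lk[of 2 "Ypow X 3"]]
  have rst: "{r, s, t} \<subseteq> transvections_of (isometries B)"
    using assms(4-6) X by auto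
  then have conj: "tweight [r ** s ** matrix_inv r, t]
      = tweight [s, t] + tweight [s, r, t] - tweight [s, t, r] - tweight [s, r] * tweight [r, t]"
    by (intro tweight_conj(2)) (auto simp: transvections_of_def)
  define w where "w = tweight [s, r, t]"
  have rev: "tweight [s, t, r] = - w"
    unfolding w_def by (rule sp_tweight_reverse[OF alt rst])
  have "2 * w = tweight [r ** s ** matrix_inv r, t] - tweight [s, t] + tweight [s, r] * tweight [r, t]"
    using conj unfolding rev w_def[symmetric] by (simp add: algebra_simps mult_2)
  also have "\<dots> \<in> ?L"
  proof -
    have "X \<subseteq> Ypow X 3" "r ** s ** matrix_inv r \<in> Ypow X 3"
      using X assms(4,5) by (simp_all add: subset_Ypow conj_mem_Ypow_3)
    then show ?thesis
      using assms(4-6) by (intro L(3,4,7) tweight_mem_Lk) auto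
  qed
  finally have two_w: "2 * w \<in> ?L" .
  have "(2::'a) \<in> ?L"
    using L(3)[OF L(2) L(2)] by (simp add: one_add_one)
  then have "inverse 2 * (2 * w) \<in> ?L"
    using two_w by (rule L(4)[OF L(6)])
  then show ?thesis
    using two by (simp add: w_def)
qed

lemma Lk_3_subset_Lk_2_Ypow_3:
  fixes B :: "'a::field^'n \<Rightarrow> 'a^'n \<Rightarrow> 'a"
  assumes alt: "alternating_form B" and X: "X \<subseteq> transvections_of (isometries B)"
    and two: "(2::'a) \<noteq> 0"
  shows "Lk 3 X \<subseteq> Lk 2 (Ypow X 3)"
  unfolding Lk_def[of 3]
proof (rule gen_subfield_least[OF is_subfield_Lk], rule subsetI)
  fix w assume "w \<in> cycle_weights X 3"
  then show "w \<in> Lk 2 (Ypow X 3)"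
    using order.refl
  proof (cases rule: cycle_weights_le_3_cases)
    case (singleton s)
    then show ?thesis
      using X tweight_singleton_eq_0 by (auto simp: transvections_of_def)
  next
    case (pair s t)
    have "X \<subseteq> Ypow X 3"
      using X by (simp add: subset_Ypow)
    then have "tweight [s, t] \<in> Lk 2 (Ypow X 3)"
      using pair by (intro tweight_mem_Lk) auto
    then show ?thesis
      using pair by simp
  next
    case (triple s r t)
    then show ?thesis
      using sp_tweight_triple_mem_Lk_2_Ypow_3[OF alt X two] by simp
  qed
qed

lemma Lk_2_subset_fixed_field:
  assumes herm: "hermitian_form \<sigma> B" and X: "X \<subseteq> transvections_of (isometries B)"
  shows "Lk 2 X \<subseteq> {a. \<sigma> a = a}"
  unfolding Lk_def
proof (rule gen_subfield_least)
  show "is_subfield {a. \<sigma> a = a}"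
    using herm unfolding hermitian_form_def by (fast intro: is_subfield_fixed_field)
  show "cycle_weights X 2 \<subseteq> {a. \<sigma> a = a}"
  proof
    fix w assume "w \<in> cycle_weights X 2"
    moreover have "2 \<le> (3::nat)"
      by simp
    ultimately show "w \<in> {a. \<sigma> a = a}"
    proof (cases rule: cycle_weights_le_3_cases)
      case (singleton s)
      then show ?thesis
        using X tweight_singleton_eq_0 by (auto simp: transvections_of_def)
    next
      case (pair s t)
      then show ?thesis
        using X su_tweight_pair_fixed[OF herm] by auto
    qed simp_all
  qed
qed

text \<open>Only q odd, X \<subseteq> \<T> and the conditions on L_3(X) (symplectic case) and on L_2(X)
  (unitary case) are needed; the remaining hypotheses are part of the paper's standing assumptions.\<close>
theorem lemma4p5:
  fixes B :: "'a::{field,finite}^'n \<Rightarrow> 'a^'n \<Rightarrow> 'a"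
    and \<sigma> :: "'a \<Rightarrow> 'a"
    and G X :: "('a^'n^'n) set"
  assumes q_odd: "odd CARD('a)"
    and dim: "CARD('n) \<ge> 4"
    and cases: "(alternating_form B \<and> G = Sp B) \<or> (hermitian_form \<sigma> B \<and> G = SU B)"
    and XT: "X \<subseteq> transvections_of G"
    and Xgen: "gen_group X = G"
    and uspan: "vec.span (tv_u ` X) = UNIV"
    and phispan: "vec.span (tv_phi ` X) = UNIV"
    and sconn: "strongly_connected X"
    and allw: "gen_subfield (all_cycle_weights X) = UNIV"
    and diam: "\<And>X''. X \<subseteq> X'' \<Longrightarrow> X'' \<subseteq> transvections_of G \<Longrightarrow>
                 diam_le X'' (dir_rel X'') 2 \<and> diam_le X'' (twoway_rel X'') 6"
    and L3: "Lk 3 X = UNIV"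
    and L2: "field_index (Lk 2 X) \<le> 2"
  shows "(alternating_form B \<and> G = Sp B \<longrightarrow> Lk 2 (Ypow X 3) = UNIV) \<and>
         (hermitian_form \<sigma> B \<and> G = SU B \<longrightarrow> Lk 2 X = {a. \<sigma> a = a})"
proof (intro conjI impI)
  assume "alternating_form B \<and> G = Sp B"
  then have "Lk 3 X \<subseteq> Lk 2 (Ypow X 3)"
    using Lk_3_subset_Lk_2_Ypow_3[of B X] XT two_neq_zero_if_odd_CARD[OF q_odd] by (simp add: Sp_def)
  then show "Lk 2 (Ypow X 3) = UNIV"
    using L3 by auto
next
  assume herm: "hermitian_form \<sigma> B \<and> G = SU B"
  then have inv: "field_involution \<sigma>"
    by (simp add: hermitian_form_def)
  have "X \<subseteq> transvections_of (isometries B)"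
    using XT herm by (auto simp: SU_def transvections_of_def)
  then have "Lk 2 X \<subseteq> {a. \<sigma> a = a}"
    using herm Lk_2_subset_fixed_field by blast
  moreover have "{a. \<sigma> a = a} \<noteq> UNIV"
    using inv by (auto simp: field_involution_def)
  ultimately show "Lk 2 X = {a. \<sigma> a = a}"
    using subfield_eq_or_UNIV_if_field_index_le_2[OF is_subfield_Lk is_subfield_fixed_field[OF inv]
        _ L2] by blast
qed

end
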